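(* Let $0<\alpha<\beta$ be real numbers and let $N\ge 2$ be an integer. There exists $\lambda_1=\lambda_1(N)>0$ satisfying $$G_1(\lambda)\ \ge\ \left(\frac{\theta_\beta}{\theta_\alpha}\right)^{\frac1{\beta-\alpha}}\qquad\text{for all }\lambda\ge\lambda_1\text{ (with }\lambda\ge 2\text{)},$$ such that for every $\lambda\ge\max\{2,\lambda_1\}$ the following holds. Put $r_0=\dfrac{G_1(\lambda)}{\sqrt{\lambda^2-1}}$, and let $q_0=(Q_1,Q_2,q_1,\dots,q_N)\in(\mathbb{R}^3)^{2+N}$ be given by $$Q_1=(0,0,r_0),\quad Q_2=(0,0,-r_0),\quad q_k=\sqrt{\lambda^2-1}\;r_0\left(\cos\tfrac{2\pi k}{N},\ \sin\tfrac{2\pi k}{N},\ 0\right)\quad(1\le k\le N).$$ Then $q(t)=E_{\omega_0}(t)q_0$, $t\in\mathbb{R}$, is a solution of the $(2+N)$-body generalized Lennard-Jones system, where $\omega_0\neq 0$ is the real constant satisfying $$\omega_0=\pm\left(\frac{\theta_\alpha}{(\sqrt{\lambda^2-1}\,r_0)^{\alpha+2}}-\frac{\theta_\beta}{(\sqrt{\lambda^2-1}\,r_0)^{\beta+2}}+\frac{2\alpha}{(\lambda r_0)^{\alpha+2}}-\frac{2\beta}{(\lambda r_0)^{\beta+2}}\right)^{\frac12}$$ (either choice of sign).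
   Context: Generalized Lennard-Jones system with $M$ bodies of unit mass and exponents $0<\alpha<\beta$: the positions $x_1,\dots,x_M\in\mathbb{R}^3$ (pairwise distinct, with $\sum_k x_k=0$) satisfy $$\ddot x_k=\sum_{j\ne k}\left(\frac{\beta}{|x_k-x_j|^{\beta+2}}-\frac{\alpha}{|x_k-x_j|^{\alpha+2}}\right)(x_k-x_j),\qquad k=1,\dots,M,$$ i.e. $\ddot x=-\nabla U(x)$ with $U(x)=\sum_{k<j}\left(|x_k-x_j|^{-\beta}-|x_k-x_j|^{-\alpha}\right)$. The $(2+N)$-body system is the case $M=2+N$. For a real constant $\omega_0\neq 0$, $$E_{\omega_0}(t)=\begin{pmatrix}\cos \omega_0t&-\sin \omega_0t&0\\ \sin \omega_0t&\cos \omega_0t&0\\0&0&1\end{pmatrix},$$ acting on each body's position separately. Constants, with $\omega_j=2\pi j/N$ for $1\le j\le N-1$ and $\mathrm{i}^2=-1$: $$\theta_\beta=\frac{\beta}{2}\sum_{j=1}^{N-1}\frac{1}{|1-e^{\mathrm{i}\omega_j}|^{\beta}},\qquad \theta_\alpha=\frac{\alpha}{2}\sum_{j=1}^{N-1}\frac{1}{|1-e^{\mathrm{i}\omega_j}|^{\alpha}}.$$ For $\lambda\ge2$, $$G_1(\lambda)=\frac{\sqrt{\lambda^2-1}}{2\lambda}\left(\frac{\beta(2\lambda^{\beta+2}+2^{\beta+2}N)}{\alpha(2\lambda^{\alpha+2}+2^{\alpha+2}N)}\right)^{\frac1{\beta-\alpha}}.$$ *)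

theory Defs
  imports "HOL-Analysis.Analysis"
begin

text \<open>Bodies are numbered \<open>1, \<dots>, M\<close>; values of a configuration outside \<open>{1..M}\<close> are irrelevant.\<close>

definition LJ_config :: "nat \<Rightarrow> (nat \<Rightarrow> real^3) set" where
  "LJ_config M = {x. inj_on x {1..M} \<and> (\<Sum>k\<in>{1..M}. x k) = 0}"

definition LJ_accel ::
  "nat \<Rightarrow> real \<Rightarrow> real \<Rightarrow> (nat \<Rightarrow> real^3) \<Rightarrow> nat \<Rightarrow> real^3" where
  "LJ_accel M \<alpha> \<beta> x k =
     (\<Sum>j\<in>{1..M} - {k}.
        (\<beta> / norm (x k - x j) powr (\<beta> + 2) - \<alpha> / norm (x k - x j) powr (\<alpha> + 2))
          *\<^sub>R (x k - x j))"

text \<open>Solutions are defined for all times; \<open>v\<close> is the velocity.\<close>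

definition LJ_solution ::
  "nat \<Rightarrow> real \<Rightarrow> real \<Rightarrow> (real \<Rightarrow> nat \<Rightarrow> real^3) \<Rightarrow> bool" where
  "LJ_solution M \<alpha> \<beta> x \<longleftrightarrow>
     (\<forall>t. x t \<in> LJ_config M) \<and>
     (\<exists>v. \<forall>t. \<forall>k\<in>{1..M}.
        ((\<lambda>s. x s k) has_vector_derivative v t k) (at t) \<and>
        ((\<lambda>s. v s k) has_vector_derivative LJ_accel M \<alpha> \<beta> (x t) k) (at t))"

definition E_rot :: "real \<Rightarrow> real \<Rightarrow> real^3^3" where
  "E_rot \<omega> t = vector
     [vector [cos (\<omega> * t), - sin (\<omega> * t), 0],
      vector [sin (\<omega> * t),   cos (\<omega> * t), 0],
      vector [0, 0, 1]]"

text \<open>\<open>\<theta>\<^sub>\<alpha>\<close> and \<open>\<theta>\<^sub>\<beta>\<close> are \<open>theta N \<alpha>\<close> and \<open>theta N \<beta>\<close>.\<close>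

definition theta :: "nat \<Rightarrow> real \<Rightarrow> real" where
  "theta N \<gamma> =
     \<gamma> / 2 * (\<Sum>j\<in>{1..N - 1}. 1 / cmod (1 - exp (\<i> * of_real (2 * pi * real j / real N))) powr \<gamma>)"

definition G1 :: "real \<Rightarrow> real \<Rightarrow> nat \<Rightarrow> real \<Rightarrow> real" where
  "G1 \<alpha> \<beta> N l =
     sqrt (l\<^sup>2 - 1) / (2 * l) *
     ((\<beta> * (2 * l powr (\<beta> + 2) + 2 powr (\<beta> + 2) * real N)) /
      (\<alpha> * (2 * l powr (\<alpha> + 2) + 2 powr (\<alpha> + 2) * real N))) powr (1 / (\<beta> - \<alpha>))"

text \<open>\<open>Q\<^sub>1, Q\<^sub>2\<close> are the bodies \<open>1, 2\<close>, and \<open>q\<^sub>k\<close> is body \<open>2 + k\<close> for \<open>1 \<le> k \<le> N\<close>.\<close>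

definition q_init :: "nat \<Rightarrow> real \<Rightarrow> real \<Rightarrow> nat \<Rightarrow> real^3" where
  "q_init N l r i =
     (if i = 1 then vector [0, 0, r]
      else if i = 2 then vector [0, 0, - r]
      else (sqrt (l\<^sup>2 - 1) * r) *\<^sub>R
             vector [cos (2 * pi * real (i - 2) / real N), sin (2 * pi * real (i - 2) / real N), 0])"

text \<open>The expression under the square root in the formula for \<open>\<omega>\<^sub>0\<close>.\<close>

definition omega_radicand :: "real \<Rightarrow> real \<Rightarrow> nat \<Rightarrow> real \<Rightarrow> real \<Rightarrow> real" where
  "omega_radicand \<alpha> \<beta> N l r =
     theta N \<alpha> / (sqrt (l\<^sup>2 - 1) * r) powr (\<alpha> + 2)
     - theta N \<beta> / (sqrt (l\<^sup>2 - 1) * r) powr (\<beta> + 2)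
     + 2 * \<alpha> / (l * r) powr (\<alpha> + 2)
     - 2 * \<beta> / (l * r) powr (\<beta> + 2)"

end

theory Submission
  imports Defs
begin

text \<open>
  Identify \<open>\<real>\<^sup>3\<close> with \<open>\<complex> \<times> \<real>\<close>, so that \<open>E_rot \<omega> t\<close> multiplies the complex coordinate by
  \<open>e\<^sup>i\<^sup>\<omega>\<^sup>t\<close>. The forces are equivariant under rotations, hence \<open>E_rot \<omega> t *v x\<close> solves the
  equations of motion as soon as the force on each body at the initial configuration \<open>x\<close> is
  \<open>- \<omega>\<^sup>2\<close> times its horizontal part (\<open>LJ_solution_rotation\<close>).

  For the bipyramid this condition is checked body by body. Each apex is at distance \<open>2 * r\<close> from
  the other apex and \<open>l * r\<close> from each ring body. The horizontal forces of the ring on it cancel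
  because the roots of unity sum to zero, and its vertical force vanishes exactly when
  \<open>r powr (\<beta> - \<alpha>)\<close> has the value encoded in \<open>G1\<close> (\<open>axial_balance\<close>). For a ring body the two apices contribute a
  horizontal radial force. The force of the other ring bodies is radial as well, because the set
  of roots of unity is closed under complex conjugation; the identity \<open>1 - Re w = |1 - w|\<^sup>2 / 2\<close> on
  the unit circle turns its size into the constants \<open>theta\<close>. The total is minus the radicand
  times the position (\<open>ring_force\<close>).

  Finally \<open>G1\<close> has a linear lower bound in \<open>l\<close> (\<open>G1_lower_bound\<close>), which gives a threshold for the
  first inequality. That inequality makes the two \<open>theta\<close> terms of the radicand nonnegative in
  total, since \<open>sqrt (l\<^sup>2 - 1) * r = G1\<close>. The two remaining terms have a positive sum exactly when
  \<open>(l * r) powr (\<beta> - \<alpha>) > \<beta> / \<alpha>\<close>, which amounts to \<open>l > 2\<close>; so the threshold is also taken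
  to be at least \<open>3\<close>.
\<close>

section \<open>Complex cylindrical coordinates\<close>

text \<open>The point of \<open>\<real>\<^sup>3\<close> with horizontal part \<open>z\<close>, read as a complex number, and height \<open>c\<close>.\<close>

definition cyl :: "complex \<Rightarrow> real \<Rightarrow> real^3" where
  "cyl z c = vector [Re z, Im z, c]"

lemma cyl_nth [simp]: "cyl z c $ 1 = Re z" "cyl z c $ 2 = Im z" "cyl z c $ 3 = c"
  by (simp_all add: cyl_def)

lemma cyl_diff: "cyl z c - cyl w d = cyl (z - w) (c - d)"
  by (simp add: vec_eq_iff forall_3)

lemma cyl_add: "cyl z c + cyl w d = cyl (z + w) (c + d)"
  by (simp add: vec_eq_iff forall_3)

lemma cyl_scaleR: "a *\<^sub>R cyl z c = cyl (of_real a * z) (a * c)"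
  by (simp add: vec_eq_iff forall_3)

lemma cyl_zero: "cyl 0 0 = 0"
  by (simp add: vec_eq_iff forall_3)

lemma cyl_sum: "(\<Sum>i\<in>A. cyl (f i) (g i)) = cyl (\<Sum>i\<in>A. f i) (\<Sum>i\<in>A. g i)"
  by (induction A rule: infinite_finite_induct) (simp_all add: cyl_zero cyl_add)

lemma cyl_eq_iff: "cyl z c = cyl w d \<longleftrightarrow> z = w \<and> c = d"
  by (auto simp: vec_eq_iff forall_3 complex_eq_iff)

lemma norm_cyl: "norm (cyl z c) = sqrt ((cmod z)\<^sup>2 + c\<^sup>2)"
  by (simp add: norm_vec_def L2_set_def sum_3 cmod_power2)

lemma E_rot_cyl: "E_rot \<omega> t *v cyl z c = cyl (cis (\<omega> * t) * z) c"
  by (simp add: vec_eq_iff forall_3 matrix_vector_mult_def E_rot_def sum_3 algebra_simps)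

lemma bounded_linear_cyl: "bounded_linear (\<lambda>z. cyl z 0)"
  unfolding linear_conv_bounded_linear [symmetric]
  by (rule linearI) (simp_all add: vec_eq_iff forall_3)

lemma cyl_rotation_has_vector_derivative:
  "((\<lambda>s. cyl (cis (\<omega> * s) * z) c) has_vector_derivative cyl (cis (\<omega> * t) * (\<i> * of_real \<omega> * z)) 0) (at t)"
proof -
  have "((\<lambda>s. exp (\<i> * of_real \<omega> * s) * z) has_field_derivative
      exp (\<i> * of_real \<omega> * of_real t) * (\<i> * of_real \<omega> * z)) (at (of_real t))"
    by (auto intro!: derivative_eq_intros)
  from has_vector_derivative_real_field [OF this]
  have "((\<lambda>s. cis (\<omega> * s) * z) has_vector_derivative cis (\<omega> * t) * (\<i> * of_real \<omega> * z)) (at t)"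
    by (simp add: cis_conv_exp mult.assoc)
  from bounded_linear.has_vector_derivative [OF bounded_linear_cyl this]
  have "((\<lambda>s. cyl (cis (\<omega> * s) * z) 0 + cyl 0 c) has_vector_derivative
      cyl (cis (\<omega> * t) * (\<i> * of_real \<omega> * z)) 0 + 0) (at t)"
    by (intro has_vector_derivative_add has_vector_derivative_const)
  then show ?thesis
    by (simp add: cyl_add)
qed

section \<open>Rotating relative equilibria\<close>

text \<open>The force coefficient of a pair of bodies at distance \<open>d\<close>.\<close>

definition LJ_coeff :: "real \<Rightarrow> real \<Rightarrow> real \<Rightarrow> real" where
  "LJ_coeff \<alpha> \<beta> d = \<beta> / d powr (\<beta> + 2) - \<alpha> / d powr (\<alpha> + 2)"

text \<open>The self-interaction term is zero, so it may be included in the sum.\<close>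

lemma LJ_accel_cyl:
  assumes "k \<in> {1..M}"
  shows "LJ_accel M \<alpha> \<beta> (\<lambda>k. cyl (Z k) (C k)) k =
    (\<Sum>j\<in>{1..M}. cyl (of_real (LJ_coeff \<alpha> \<beta> (sqrt ((cmod (Z k - Z j))\<^sup>2 + (C k - C j)\<^sup>2))) * (Z k - Z j))
       (LJ_coeff \<alpha> \<beta> (sqrt ((cmod (Z k - Z j))\<^sup>2 + (C k - C j)\<^sup>2)) * (C k - C j)))"
  unfolding LJ_accel_def
  by (rule sum.mono_neutral_cong_left)
    (auto simp: LJ_coeff_def cyl_diff norm_cyl cyl_scaleR cyl_zero)

lemma LJ_accel_rotation:
  assumes "k \<in> {1..M}"
  shows "LJ_accel M \<alpha> \<beta> (\<lambda>k. cyl (cis \<phi> * Z k) (C k)) k =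
    cyl (cis \<phi> * Complex (LJ_accel M \<alpha> \<beta> (\<lambda>k. cyl (Z k) (C k)) k $ 1)
                         (LJ_accel M \<alpha> \<beta> (\<lambda>k. cyl (Z k) (C k)) k $ 2))
        (LJ_accel M \<alpha> \<beta> (\<lambda>k. cyl (Z k) (C k)) k $ 3)"
proof -
  have [simp]: "cmod (cis \<phi> * z - cis \<phi> * w) = cmod (z - w)" for z w
    by (simp add: right_diff_distrib [symmetric] norm_mult)
  have [simp]: "Complex (Re z) (Im z) = z" for z
    by simp
  show ?thesis
    unfolding LJ_accel_cyl [OF assms] cyl_sum
    by (simp add: cyl_eq_iff sum_distrib_left algebra_simps del: Re_sum Im_sum)
qed

lemma LJ_solution_rotation:
  assumes x: "\<And>k. k \<in> {1..M} \<Longrightarrow> x k = cyl (Z k) (C k)"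
    and config: "x \<in> LJ_config M"
    and accel: "\<And>k. k \<in> {1..M} \<Longrightarrow>
      LJ_accel M \<alpha> \<beta> (\<lambda>k. cyl (Z k) (C k)) k = cyl (- of_real (\<omega>\<^sup>2) * Z k) 0"
  shows "LJ_solution M \<alpha> \<beta> (\<lambda>t k. E_rot \<omega> t *v x k)"
proof -
  have rot: "E_rot \<omega> t *v x k = cyl (cis (\<omega> * t) * Z k) (C k)" if "k \<in> {1..M}" for t k
    using x [OF that] by (simp add: E_rot_cyl)
  define v where "v t k = cyl (cis (\<omega> * t) * (\<i> * of_real \<omega> * Z k)) 0" for t k
  have acc: "LJ_accel M \<alpha> \<beta> (\<lambda>k. E_rot \<omega> t *v x k) k =
      cyl (cis (\<omega> * t) * (\<i> * of_real \<omega> * (\<i> * of_real \<omega> * Z k))) 0" if k: "k \<in> {1..M}" for t k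
  proof -
    have "LJ_accel M \<alpha> \<beta> (\<lambda>k. E_rot \<omega> t *v x k) k =
        LJ_accel M \<alpha> \<beta> (\<lambda>k. cyl (cis (\<omega> * t) * Z k) (C k)) k"
      unfolding LJ_accel_def using k by (intro sum.cong) (auto simp: rot)
    also have "\<dots> = cyl (cis (\<omega> * t) * (- of_real (\<omega>\<^sup>2) * Z k)) 0"
      unfolding LJ_accel_rotation [OF k] accel [OF k] cyl_nth complex_surj ..
    also have "- of_real (\<omega>\<^sup>2) * Z k = \<i> * of_real \<omega> * (\<i> * of_real \<omega> * Z k)"
      by (simp add: complex_eq_iff power2_eq_square algebra_simps)
    finally show ?thesis .
  qed
  have conf: "(\<lambda>k. E_rot \<omega> t *v x k) \<in> LJ_config M" for t
  proof -
    have "inj_on (\<lambda>k. E_rot \<omega> t *v x k) {1..M}"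
    proof (rule inj_onI)
      fix j k assume jk: "j \<in> {1..M}" "k \<in> {1..M}" "E_rot \<omega> t *v x j = E_rot \<omega> t *v x k"
      then have "x j = x k"
        unfolding rot [OF jk(1)] rot [OF jk(2)] unfolding x [OF jk(1)] x [OF jk(2)] cyl_eq_iff by simp
      with config jk show "j = k"
        by (auto simp: LJ_config_def dest: inj_onD)
    qed
    moreover have "(\<Sum>k\<in>{1..M}. E_rot \<omega> t *v x k) = E_rot \<omega> t *v (\<Sum>k\<in>{1..M}. x k)"
      by (simp add: linear_sum [OF matrix_vector_mul_linear])
    ultimately show ?thesis
      using config by (simp add: LJ_config_def)
  qed
  have "((\<lambda>s. E_rot \<omega> s *v x k) has_vector_derivative v t k) (at t)"
    "((\<lambda>s. v s k) has_vector_derivative LJ_accel M \<alpha> \<beta> (\<lambda>k. E_rot \<omega> t *v x k) k) (at t)"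
    if k: "k \<in> {1..M}" for t k
    unfolding rot [OF k] acc [OF k] v_def by (rule cyl_rotation_has_vector_derivative)+
  with conf show ?thesis
    unfolding LJ_solution_def by blast
qed

section \<open>Sums over the roots of unity\<close>

lemma bij_betw_roots_unity_atLeastAtMost:
  assumes "N > 0"
  shows "bij_betw (\<lambda>k. cis (2 * pi * real k / real N)) {1..N} {z. z ^ N = 1}"
proof -
  let ?f = "\<lambda>k. cis (2 * pi * real k / real N)"
  have "bij_betw (\<lambda>k. if k = N then 0 else k) {1..N} {..<N}"
    using assms by (intro bij_betw_byWitness [where f' = "\<lambda>k. if k = 0 then N else k"]) auto
  from bij_betw_trans [OF this Complex.bij_betw_roots_unity [OF assms]]
  show ?thesis
    by (rule bij_betw_cong [THEN iffD1, rotated]) (use assms in auto)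
qed

text \<open>The root \<open>w = 1\<close> contributes nothing, because \<open>0 powr \<gamma> = 0\<close> and \<open>1 / 0 = 0\<close>.\<close>

lemma theta_roots_unity:
  assumes "N > 0"
  shows "theta N \<gamma> = \<gamma> / 2 * (\<Sum>w\<in>{z. z ^ N = 1}. 1 / cmod (1 - w) powr \<gamma>)"
proof -
  have "(\<Sum>w\<in>{z. z ^ N = 1}. 1 / cmod (1 - w) powr \<gamma>) =
      (\<Sum>k\<in>{1..N}. 1 / cmod (1 - cis (2 * pi * real k / real N)) powr \<gamma>)"
    by (rule sum.reindex_bij_betw [symmetric, OF bij_betw_roots_unity_atLeastAtMost [OF assms]])
  also have "{1..N} = insert N {1..N - 1}"
    using assms by auto
  also have "(\<Sum>k\<in>\<dots>. 1 / cmod (1 - cis (2 * pi * real k / real N)) powr \<gamma>) =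
      (\<Sum>k\<in>{1..N - 1}. 1 / cmod (1 - cis (2 * pi * real k / real N)) powr \<gamma>)"
    using assms by (subst sum.insert) auto
  finally show ?thesis
    by (simp add: theta_def cis_conv_exp)
qed

lemma theta_pos:
  assumes "N \<ge> 2" "\<gamma> > 0"
  shows "theta N \<gamma> > 0"
proof -
  have N: "N > 0"
    using assms by simp
  define u where "u = cis (2 * pi * real 1 / real N)"
  note bij = bij_betw_roots_unity_atLeastAtMost [OF N]
  have "u \<in> {z. z ^ N = 1}"
    unfolding u_def by (rule bij_betw_apply [OF bij]) (use N in simp)
  moreover have "u \<noteq> 1"
  proof
    assume "u = 1"
    then have "cis (2 * pi * real 1 / real N) = cis (2 * pi * real N / real N)"
      using N by (simp add: u_def)
    from inj_onD [OF bij_betw_imp_inj_on [OF bij] this] N have "1 = N"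
      by simp
    with assms(1) show False
      by simp
  qed
  ultimately have "(\<Sum>w\<in>{z. z ^ N = 1}. 1 / cmod (1 - w) powr \<gamma>) > 0"
    using finite_roots_unity [of N] assms(1) by (intro sum_pos2 [of _ u]) auto
  then show ?thesis
    using assms(2) by (simp add: theta_roots_unity [OF N])
qed

text \<open>
  A central pair force exerted on the root \<open>u\<close> by all roots of unity is radial: by rotation it
  suffices to take \<open>u = 1\<close>, where conjugate roots pair up.
\<close>

lemma sum_roots_unity_central_force:
  fixes F :: "real \<Rightarrow> real"
  assumes N: "N > 0" and u: "u ^ N = 1"
  shows "(\<Sum>w\<in>{z. z ^ N = 1}. of_real (F (cmod (u - w))) * (u - w)) =
    u * of_real (\<Sum>w\<in>{z. z ^ N = 1}. F (cmod (1 - w)) * (cmod (1 - w))\<^sup>2 / 2)"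
proof -
  let ?S = "{z::complex. z ^ N = 1}"
  have unit: "cmod w = 1" if "w ^ N = 1" for w :: complex
  proof -
    have "cmod w ^ N = 1 ^ N"
      using that by (metis norm_one norm_power power_one)
    then show ?thesis
      using N by (metis norm_ge_zero power_eq_imp_eq_base zero_le_one)
  qed
  have u0: "u \<noteq> 0"
    using u N by (auto simp: power_0_left)
  have "bij_betw (\<lambda>w. u * w) ?S ?S"
    using u u0 by (intro bij_betw_byWitness [where f' = "\<lambda>w. w / u"])
      (auto simp: power_mult_distrib power_divide)
  from sum.reindex_bij_betw [OF this, of "\<lambda>w. of_real (F (cmod (u - w))) * (u - w)"]
  have "(\<Sum>w\<in>?S. of_real (F (cmod (u - w))) * (u - w)) =
      (\<Sum>w\<in>?S. of_real (F (cmod (u - u * w))) * (u - u * w))"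
    by simp
  also have "\<dots> = (\<Sum>w\<in>?S. u * (of_real (F (cmod (1 - w))) * (1 - w)))"
  proof (rule sum.cong)
    fix w
    have "u - u * w = u * (1 - w)"
      by (simp add: algebra_simps)
    then show "of_real (F (cmod (u - u * w))) * (u - u * w) = u * (of_real (F (cmod (1 - w))) * (1 - w))"
      by (simp add: norm_mult unit [OF u])
  qed simp
  also have "\<dots> = u * (\<Sum>w\<in>?S. of_real (F (cmod (1 - w))) * (1 - w))"
    by (rule sum_distrib_left [symmetric])
  also have "(\<Sum>w\<in>?S. of_real (F (cmod (1 - w))) * (1 - w)) =
      of_real (\<Sum>w\<in>?S. F (cmod (1 - w)) * (cmod (1 - w))\<^sup>2 / 2)" (is "?s = _")
  proof -
    have "bij_betw cnj ?S ?S"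
      by (intro bij_betw_byWitness [where f' = cnj]) (auto simp flip: complex_cnj_power)
    from sum.reindex_bij_betw [OF this, of "\<lambda>w. of_real (F (cmod (1 - w))) * (1 - w)"]
    have "?s = (\<Sum>w\<in>?S. of_real (F (cmod (1 - cnj w))) * (1 - cnj w))"
      by simp
    also have "\<dots> = cnj ?s"
    proof -
      have "cmod (1 - cnj w) = cmod (1 - w)" for w
        by (metis complex_cnj_diff complex_cnj_one complex_mod_cnj)
      then show ?thesis
        by simp
    qed
    finally have "Im ?s = 0"
      by (metis Reals_cnj_iff complex_is_Real_iff)
    moreover have "Re ?s = (\<Sum>w\<in>?S. F (cmod (1 - w)) * (cmod (1 - w))\<^sup>2 / 2)"
    proof -
      have "1 - Re w = (cmod (1 - w))\<^sup>2 / 2" if "w ^ N = 1" for w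
      proof -
        have "(Re w)\<^sup>2 + (Im w)\<^sup>2 = 1"
          using unit [OF that] by (metis cmod_power2 one_power2)
        moreover have "(cmod (1 - w))\<^sup>2 = (1 - Re w)\<^sup>2 + (Im w)\<^sup>2"
          by (simp add: cmod_power2)
        ultimately show ?thesis
          by (simp add: power2_diff)
      qed
      then show ?thesis
        by (auto intro!: sum.cong)
    qed
    ultimately show ?thesis
      by (simp add: complex_eq_iff)
  qed
  finally show ?thesis .
qed

lemma theta_scaled:
  assumes "N > 0" "R > 0"
  shows "(\<Sum>w\<in>{z. z ^ N = 1}. \<gamma> / (R * cmod (1 - w)) powr (\<gamma> + 2) * (cmod (1 - w))\<^sup>2 / 2) =
    theta N \<gamma> / R powr (\<gamma> + 2)"
proof -
  have "\<gamma> / (R * cmod (1 - w)) powr (\<gamma> + 2) * (cmod (1 - w))\<^sup>2 / 2 =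
      \<gamma> / 2 / R powr (\<gamma> + 2) * (1 / cmod (1 - w) powr \<gamma>)" for w
  proof (cases "w = 1")
    case False
    then show ?thesis
      by (simp add: powr_mult powr_add)
  qed simp
  then have "(\<Sum>w\<in>{z. z ^ N = 1}. \<gamma> / (R * cmod (1 - w)) powr (\<gamma> + 2) * (cmod (1 - w))\<^sup>2 / 2) =
      \<gamma> / 2 / R powr (\<gamma> + 2) * (\<Sum>w\<in>{z. z ^ N = 1}. 1 / cmod (1 - w) powr \<gamma>)"
    by (simp only: sum_distrib_left)
  then show ?thesis
    by (simp add: theta_roots_unity [OF assms(1)])
qed

section \<open>The bipyramid configuration\<close>

text \<open>Horizontal part and height of the bodies; \<open>R\<close> is the radius of the ring.\<close>

definition bipyramid_hor :: "nat \<Rightarrow> real \<Rightarrow> nat \<Rightarrow> complex" where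
  "bipyramid_hor N R k = (if k \<le> 2 then 0 else of_real R * cis (2 * pi * real (k - 2) / real N))"

definition bipyramid_height :: "real \<Rightarrow> nat \<Rightarrow> real" where
  "bipyramid_height r k = (if k = 1 then r else if k = 2 then - r else 0)"

lemma q_init_cyl:
  assumes "k \<ge> 1"
  shows "q_init N l r k = cyl (bipyramid_hor N (sqrt (l\<^sup>2 - 1) * r) k) (bipyramid_height r k)"
proof -
  consider "k = 1" | "k = 2" | "k > 2"
    using assms by linarith
  then show ?thesis
    by cases (simp_all add: q_init_def bipyramid_hor_def bipyramid_height_def vec_eq_iff forall_3)
qed

lemma sum_bodies:
  fixes f :: "nat \<Rightarrow> 'a::comm_monoid_add"
  shows "sum f {1..2 + N} = f 1 + f 2 + (\<Sum>j\<in>{1..N}. f (2 + j))"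
proof -
  have "{1..2::nat} = {1, 2}"
    by auto
  then show ?thesis
    by (induction N) (simp_all add: add.assoc)
qed

text \<open>The sum over the ring bodies as a sum over the roots of unity.\<close>

lemma sum_ring:
  assumes "N > 0"
  shows "(\<Sum>j\<in>{1..N}. f (bipyramid_hor N R (2 + j))) = (\<Sum>w\<in>{z. z ^ N = 1}. f (of_real R * w))"
proof -
  have "(\<Sum>j\<in>{1..N}. f (bipyramid_hor N R (2 + j))) =
      (\<Sum>j\<in>{1..N}. f (of_real R * cis (2 * pi * real j / real N)))"
    by (rule sum.cong) (auto simp: bipyramid_hor_def)
  also have "\<dots> = (\<Sum>w\<in>{z. z ^ N = 1}. f (of_real R * w))"
    by (rule sum.reindex_bij_betw [OF bij_betw_roots_unity_atLeastAtMost [OF assms]])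
  finally show ?thesis .
qed

lemma sum_ring_zero:
  assumes "N \<ge> 2"
  shows "(\<Sum>j\<in>{1..N}. bipyramid_hor N R (2 + j)) = 0"
  using sum_ring [of N "\<lambda>z. z" R] sum_roots_unity [of N] assms
  by (simp add: sum_distrib_left [symmetric])

lemma q_init_in_LJ_config:
  assumes N: "N \<ge> 2" and l: "l > 1" and r: "r > 0"
  shows "q_init N l r \<in> LJ_config (2 + N)"
proof -
  define R where "R = sqrt (l\<^sup>2 - 1) * r"
  have R: "R > 0"
    using l r by (simp add: R_def one_less_power)
  have q: "q_init N l r k = cyl (bipyramid_hor N R k) (bipyramid_height r k)" if "k \<in> {1..2 + N}" for k
    unfolding R_def using that by (intro q_init_cyl) auto
  have "inj_on (q_init N l r) {1..2 + N}"
  proof (rule inj_onI)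
    fix j k assume jk: "j \<in> {1..2 + N}" "k \<in> {1..2 + N}" "q_init N l r j = q_init N l r k"
    then have hor: "bipyramid_hor N R j = bipyramid_hor N R k"
      and height: "bipyramid_height r j = bipyramid_height r k"
      by (simp_all only: q cyl_eq_iff)
    show "j = k"
    proof (cases "j \<le> 2 \<or> k \<le> 2")
      case True
      with height jk r show ?thesis
        by (auto simp: bipyramid_height_def split: if_splits)
    next
      case False
      then have "cis (2 * pi * real (j - 2) / real N) = cis (2 * pi * real (k - 2) / real N)"
        using hor R by (simp add: bipyramid_hor_def)
      moreover have "j - 2 \<in> {1..N}" "k - 2 \<in> {1..N}"
        using False jk by auto
      ultimately have "j - 2 = k - 2"
        using bij_betw_roots_unity_atLeastAtMost [of N] N by (auto simp: bij_betw_def dest: inj_onD)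
      with False show ?thesis
        by linarith
    qed
  qed
  moreover have "(\<Sum>k\<in>{1..2 + N}. q_init N l r k) =
      (\<Sum>k\<in>{1..2 + N}. cyl (bipyramid_hor N R k) (bipyramid_height r k))"
    by (rule sum.cong [OF refl q])
  then have "(\<Sum>k\<in>{1..2 + N}. q_init N l r k) = 0"
    unfolding cyl_sum sum_bodies sum_ring_zero [OF N]
    by (simp add: bipyramid_hor_def bipyramid_height_def cyl_zero)
  ultimately show ?thesis
    by (simp add: LJ_config_def)
qed

text \<open>
  Forces on the apices, where \<open>d\<close> is the distance between an apex and a ring body. The sign \<open>s\<close>
  distinguishes the two apices.
\<close>

lemma apex_force:
  assumes N: "N \<ge> 2" and R: "R > 0" and r: "r > 0" and d: "d = sqrt (R\<^sup>2 + r\<^sup>2)"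
    and k: "k = 1 \<and> s = 1 \<or> k = 2 \<and> s = (- 1 :: real)"
  shows "LJ_accel (2 + N) \<alpha> \<beta> (\<lambda>k. cyl (bipyramid_hor N R k) (bipyramid_height r k)) k =
    cyl 0 (s * r * (2 * LJ_coeff \<alpha> \<beta> (2 * r) + real N * LJ_coeff \<alpha> \<beta> d))"
proof -
  have "k \<in> {1..2 + N}"
    using k by auto
  note accel = LJ_accel_cyl [OF this, of \<alpha> \<beta> "bipyramid_hor N R" "bipyramid_height r"]
  have ring: "cmod (bipyramid_hor N R (2 + j)) = R" "bipyramid_height r (2 + j) = 0"
    if "j \<in> {1..N}" for j
    using that R by (auto simp: bipyramid_hor_def bipyramid_height_def norm_mult)
  have apex: "bipyramid_hor N R k = 0" "bipyramid_height r k = s * r"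
    using k by (auto simp: bipyramid_hor_def bipyramid_height_def)
  have s: "(s * r)\<^sup>2 = r\<^sup>2"
    using k by auto
  have terms: "(\<Sum>j\<in>{1..N}. cyl
        (of_real (LJ_coeff \<alpha> \<beta> (sqrt ((cmod (bipyramid_hor N R k - bipyramid_hor N R (2 + j)))\<^sup>2
            + (bipyramid_height r k - bipyramid_height r (2 + j))\<^sup>2)))
          * (bipyramid_hor N R k - bipyramid_hor N R (2 + j)))
        (LJ_coeff \<alpha> \<beta> (sqrt ((cmod (bipyramid_hor N R k - bipyramid_hor N R (2 + j)))\<^sup>2
            + (bipyramid_height r k - bipyramid_height r (2 + j))\<^sup>2))
          * (bipyramid_height r k - bipyramid_height r (2 + j)))) =
      (\<Sum>j\<in>{1..N}. cyl (of_real (LJ_coeff \<alpha> \<beta> d) * - bipyramid_hor N R (2 + j))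
        (LJ_coeff \<alpha> \<beta> d * (s * r)))"
    by (intro sum.cong refl) (simp only: ring apex norm_minus_cancel diff_0 diff_0_right s d)
  have ring_sum: "(\<Sum>j\<in>{1..N}. cyl (of_real (LJ_coeff \<alpha> \<beta> d) * - bipyramid_hor N R (2 + j))
      (LJ_coeff \<alpha> \<beta> d * (s * r))) = cyl 0 (real N * (LJ_coeff \<alpha> \<beta> d * (s * r)))"
    unfolding cyl_sum sum_distrib_left [symmetric] sum_negf sum_ring_zero [OF N]
    by (simp add: mult_ac)
  have apices: "bipyramid_hor N R 1 = 0" "bipyramid_hor N R 2 = 0"
    "bipyramid_height r 1 = r" "bipyramid_height r 2 = - r"
    by (simp_all add: bipyramid_hor_def bipyramid_height_def)
  have "r - - r = 2 * r" "- r - r = - (2 * r)"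
    by simp_all
  then have dist: "sqrt ((cmod (0 - 0))\<^sup>2 + (r - - r)\<^sup>2) = 2 * r"
    "sqrt ((cmod (0 - 0))\<^sup>2 + (- r - r)\<^sup>2) = 2 * r"
    using r by (simp_all add: real_sqrt_mult)
  from k show ?thesis
  proof
    assume k1: "k = 1 \<and> s = 1"
    show ?thesis
      unfolding accel sum_bodies terms ring_sum
      unfolding conjunct1 [OF k1] conjunct2 [OF k1] apices dist cyl_add cyl_eq_iff
      by (simp add: distrib_left)
  next
    assume k2: "k = 2 \<and> s = - 1"
    show ?thesis
      unfolding accel sum_bodies terms ring_sum
      unfolding conjunct1 [OF k2] conjunct2 [OF k2] apices dist cyl_add cyl_eq_iff
      by (simp add: distrib_left)
  qed
qed

text \<open>
  Force on a ring body. The vertical forces of the two apices cancel, and the horizontal ones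
  coincide.
\<close>

lemma ring_force:
  assumes N: "N \<ge> 2" and R: "R > 0" and d: "d = sqrt (R\<^sup>2 + r\<^sup>2)" and k: "k \<in> {3..2 + N}"
  shows "LJ_accel (2 + N) \<alpha> \<beta> (\<lambda>k. cyl (bipyramid_hor N R k) (bipyramid_height r k)) k =
    cyl (of_real (theta N \<beta> / R powr (\<beta> + 2) - theta N \<alpha> / R powr (\<alpha> + 2) + 2 * LJ_coeff \<alpha> \<beta> d)
          * bipyramid_hor N R k) 0"
proof -
  let ?S = "{z::complex. z ^ N = 1}"
  have k': "k \<in> {1..2 + N}"
    using k by auto
  note accel = LJ_accel_cyl [OF this, of \<alpha> \<beta> "bipyramid_hor N R" "bipyramid_height r"]
  define u where "u = cis (2 * pi * real (k - 2) / real N)"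
  have "k - 2 \<in> {1..N}"
    using k by auto
  then have "u \<in> {z. z ^ N = 1}"
    unfolding u_def by (rule bij_betw_apply [OF bij_betw_roots_unity_atLeastAtMost, rotated]) (use N in simp)
  then have u: "u ^ N = 1"
    by simp
  have hor: "bipyramid_hor N R k = of_real R * u"
    using k by (simp add: bipyramid_hor_def u_def)
  have norm_hor: "cmod (bipyramid_hor N R k) = R"
    using R by (simp add: hor norm_mult u_def)
  have height: "bipyramid_height r k = 0" "\<And>j. j \<in> {1..N} \<Longrightarrow> bipyramid_height r (2 + j) = 0"
    using k by (auto simp: bipyramid_height_def)
  have "(\<Sum>j\<in>{1..N}. cyl
        (of_real (LJ_coeff \<alpha> \<beta> (sqrt ((cmod (bipyramid_hor N R k - bipyramid_hor N R (2 + j)))\<^sup>2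
            + (bipyramid_height r k - bipyramid_height r (2 + j))\<^sup>2)))
          * (bipyramid_hor N R k - bipyramid_hor N R (2 + j)))
        (LJ_coeff \<alpha> \<beta> (sqrt ((cmod (bipyramid_hor N R k - bipyramid_hor N R (2 + j)))\<^sup>2
            + (bipyramid_height r k - bipyramid_height r (2 + j))\<^sup>2))
          * (bipyramid_height r k - bipyramid_height r (2 + j)))) =
      (\<Sum>j\<in>{1..N}. cyl
        (of_real (LJ_coeff \<alpha> \<beta> (cmod (of_real R * u - bipyramid_hor N R (2 + j))))
          * (of_real R * u - bipyramid_hor N R (2 + j))) 0)"
    by (intro sum.cong refl) (simp only: height hor, simp)
  also have "\<dots> = cyl (\<Sum>w\<in>?S. of_real (LJ_coeff \<alpha> \<beta> (cmod (of_real R * u - of_real R * w)))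
          * (of_real R * u - of_real R * w)) 0"
    unfolding cyl_sum using N by (subst sum_ring [where f =
      "\<lambda>z. of_real (LJ_coeff \<alpha> \<beta> (cmod (of_real R * u - z))) * (of_real R * u - z)"]) simp_all
  also have "(\<Sum>w\<in>?S. of_real (LJ_coeff \<alpha> \<beta> (cmod (of_real R * u - of_real R * w)))
          * (of_real R * u - of_real R * w)) =
      of_real R * (\<Sum>w\<in>?S. of_real (LJ_coeff \<alpha> \<beta> (R * cmod (u - w))) * (u - w))"
    using R by (simp add: norm_mult sum_distrib_left mult.left_commute flip: right_diff_distrib)
  also have "(\<Sum>w\<in>?S. of_real (LJ_coeff \<alpha> \<beta> (R * cmod (u - w))) * (u - w)) =
      u * of_real (\<Sum>w\<in>?S. LJ_coeff \<alpha> \<beta> (R * cmod (1 - w)) * (cmod (1 - w))\<^sup>2 / 2)"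
    using N by (intro sum_roots_unity_central_force [OF _ u]) simp
  also have "(\<Sum>w\<in>?S. LJ_coeff \<alpha> \<beta> (R * cmod (1 - w)) * (cmod (1 - w))\<^sup>2 / 2) =
      theta N \<beta> / R powr (\<beta> + 2) - theta N \<alpha> / R powr (\<alpha> + 2)"
    using N by (simp add: LJ_coeff_def left_diff_distrib diff_divide_distrib sum_subtractf
        theta_scaled [OF _ R, simplified])
  finally have ring: "(\<Sum>j\<in>{1..N}. cyl
        (of_real (LJ_coeff \<alpha> \<beta> (sqrt ((cmod (bipyramid_hor N R k - bipyramid_hor N R (2 + j)))\<^sup>2
            + (bipyramid_height r k - bipyramid_height r (2 + j))\<^sup>2)))
          * (bipyramid_hor N R k - bipyramid_hor N R (2 + j)))
        (LJ_coeff \<alpha> \<beta> (sqrt ((cmod (bipyramid_hor N R k - bipyramid_hor N R (2 + j)))\<^sup>2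
            + (bipyramid_height r k - bipyramid_height r (2 + j))\<^sup>2))
          * (bipyramid_height r k - bipyramid_height r (2 + j)))) =
      cyl (of_real R * (u * of_real (theta N \<beta> / R powr (\<beta> + 2) - theta N \<alpha> / R powr (\<alpha> + 2)))) 0" .
  have apices: "bipyramid_hor N R 1 = 0" "bipyramid_hor N R 2 = 0"
    "bipyramid_height r 1 = r" "bipyramid_height r 2 = - r"
    by (simp_all add: bipyramid_hor_def bipyramid_height_def)
  show ?thesis
    unfolding accel sum_bodies ring
    unfolding apices diff_0_right norm_hor height
    by (simp add: cyl_add cyl_eq_iff hor flip: d) (simp add: algebra_simps)
qed

section \<open>The size of the bipyramid\<close>

text \<open>The quotient whose \<open>(\<beta> - \<alpha>)\<close>-th root occurs in \<open>G1\<close>.\<close>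

definition G1_quotient :: "real \<Rightarrow> real \<Rightarrow> nat \<Rightarrow> real \<Rightarrow> real" where
  "G1_quotient \<alpha> \<beta> N l =
     (\<beta> * (2 * l powr (\<beta> + 2) + 2 powr (\<beta> + 2) * real N)) /
     (\<alpha> * (2 * l powr (\<alpha> + 2) + 2 powr (\<alpha> + 2) * real N))"

lemma G1_quotient_pos:
  assumes "0 < \<alpha>" "\<alpha> < \<beta>" "l > 0"
  shows "G1_quotient \<alpha> \<beta> N l > 0"
  using assms unfolding G1_quotient_def
  by (intro divide_pos_pos mult_pos_pos add_pos_nonneg) auto

lemma G1_div_sqrt:
  assumes "l > 1"
  shows "G1 \<alpha> \<beta> N l / sqrt (l\<^sup>2 - 1) = G1_quotient \<alpha> \<beta> N l powr (1 / (\<beta> - \<alpha>)) / (2 * l)"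
proof -
  have "l\<^sup>2 \<noteq> 1"
    using assms by (simp add: power2_eq_1_iff)
  then show ?thesis
    by (simp add: G1_def G1_quotient_def)
qed

lemma diameter_powr:
  assumes "0 < \<alpha>" "\<alpha> < \<beta>" "l > 1" and r: "r = G1 \<alpha> \<beta> N l / sqrt (l\<^sup>2 - 1)"
  shows "r > 0" "(2 * l * r) powr (\<beta> - \<alpha>) = G1_quotient \<alpha> \<beta> N l"
proof -
  have eq: "2 * l * r = G1_quotient \<alpha> \<beta> N l powr (1 / (\<beta> - \<alpha>))"
    using assms by (simp add: r G1_div_sqrt)
  have pos: "G1_quotient \<alpha> \<beta> N l > 0"
    using assms by (intro G1_quotient_pos) auto
  show "(2 * l * r) powr (\<beta> - \<alpha>) = G1_quotient \<alpha> \<beta> N l"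
    using assms pos unfolding eq by (simp add: powr_powr)
  show "r > 0"
    using assms pos by (simp add: r G1_div_sqrt)
qed

lemma axial_balance:
  assumes ab: "0 < \<alpha>" "\<alpha> < \<beta>" and l: "l > 1" and r: "r = G1 \<alpha> \<beta> N l / sqrt (l\<^sup>2 - 1)"
  shows "2 * LJ_coeff \<alpha> \<beta> (2 * r) + real N * LJ_coeff \<alpha> \<beta> (l * r) = 0"
proof -
  have r0: "r > 0"
    using diameter_powr [OF ab l r] by simp
  define W where "W \<gamma> = 2 * l powr (\<gamma> + 2) + 2 powr (\<gamma> + 2) * real N" for \<gamma>
  define D where "D \<gamma> = (2 * l * r) powr (\<gamma> + 2)" for \<gamma>
  have W: "W \<gamma> > 0" and D: "D \<gamma> > 0" for \<gamma>
    using l r0 by (auto simp: W_def D_def intro!: add_pos_nonneg)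
  \<comment> \<open>Both distances are brought to the common denominator \<open>(2 * l * r) powr (\<gamma> + 2)\<close>.\<close>
  have single: "2 * (\<gamma> / (2 * r) powr (\<gamma> + 2)) + real N * (\<gamma> / (l * r) powr (\<gamma> + 2)) = \<gamma> * W \<gamma> / D \<gamma>" for \<gamma>
    using l r0 by (simp add: W_def D_def powr_mult field_simps)
  have "D \<beta> = D \<alpha> * (2 * l * r) powr (\<beta> - \<alpha>)"
    by (simp add: D_def powr_add [symmetric] add.commute)
  also have "\<dots> = D \<alpha> * (\<beta> * W \<beta> / (\<alpha> * W \<alpha>))"
    using diameter_powr [OF ab l r] by (simp add: G1_quotient_def W_def)
  finally have "\<beta> * W \<beta> / D \<beta> = \<alpha> * W \<alpha> / D \<alpha>"
    using W [of \<alpha>] W [of \<beta>] D [of \<alpha>] D [of \<beta>] ab by (simp add: field_simps)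
  with single [of \<alpha>] single [of \<beta>] show ?thesis
    by (simp add: LJ_coeff_def algebra_simps)
qed

text \<open>
  A linear lower bound. The constant term of the denominator of \<open>G1_quotient\<close> is at most \<open>N\<close>
  times the power \<open>l powr (\<alpha> + 2)\<close>, since \<open>l \<ge> 2\<close>.
\<close>

lemma G1_lower_bound:
  assumes ab: "0 < \<alpha>" "\<alpha> < \<beta>" and l: "l \<ge> 2"
  shows "G1 \<alpha> \<beta> N l \<ge> (2 * \<beta> / (\<alpha> * (2 + real N))) powr (1 / (\<beta> - \<alpha>)) / 4 * l"
proof -
  have "2 powr (\<alpha> + 2) \<le> l powr (\<alpha> + 2)"
    using ab l by (intro powr_mono2) auto
  then have den: "2 * l powr (\<alpha> + 2) + 2 powr (\<alpha> + 2) * real N \<le> (2 + real N) * l powr (\<alpha> + 2)"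
    using mult_right_mono [of "2 powr (\<alpha> + 2)" "l powr (\<alpha> + 2)" "real N"] by (simp add: algebra_simps)
  have "2 * \<beta> / (\<alpha> * (2 + real N)) * l powr (\<beta> - \<alpha>) =
      (\<beta> * (2 * l powr (\<beta> + 2))) / (\<alpha> * ((2 + real N) * l powr (\<alpha> + 2)))"
    using l powr_add [of l "\<beta> - \<alpha>" "\<alpha> + 2"] by simp
  also have "\<dots> \<le> G1_quotient \<alpha> \<beta> N l"
    unfolding G1_quotient_def using ab l den
    by (intro frac_le mult_left_mono mult_pos_pos add_pos_nonneg mult_nonneg_nonneg add_nonneg_nonneg) auto
  finally have "(2 * \<beta> / (\<alpha> * (2 + real N)) * l powr (\<beta> - \<alpha>)) powr (1 / (\<beta> - \<alpha>)) \<le>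
      G1_quotient \<alpha> \<beta> N l powr (1 / (\<beta> - \<alpha>))"
    using ab by (intro powr_mono2) auto
  moreover have "(l powr (\<beta> - \<alpha>)) powr (1 / (\<beta> - \<alpha>)) = l"
    using ab l by (simp add: powr_powr)
  ultimately have quot: "(2 * \<beta> / (\<alpha> * (2 + real N))) powr (1 / (\<beta> - \<alpha>)) * l \<le>
      G1_quotient \<alpha> \<beta> N l powr (1 / (\<beta> - \<alpha>))"
    by (simp only: powr_mult)
  have "(l / 2)\<^sup>2 \<le> l\<^sup>2 - 1"
    using power_mono [of 2 l 2] l by (simp add: power_divide)
  then have "l / 2 \<le> sqrt (l\<^sup>2 - 1)"
    by (rule real_le_rsqrt)
  then have "1 / 4 \<le> sqrt (l\<^sup>2 - 1) / (2 * l)"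
    using l by (simp add: field_simps)
  then have "1 / 4 * ((2 * \<beta> / (\<alpha> * (2 + real N))) powr (1 / (\<beta> - \<alpha>)) * l) \<le>
      sqrt (l\<^sup>2 - 1) / (2 * l) * G1_quotient \<alpha> \<beta> N l powr (1 / (\<beta> - \<alpha>))"
    using quot l by (intro mult_mono) auto
  then show ?thesis
    by (simp add: G1_def G1_quotient_def)
qed

lemma frac_powr_compare:
  fixes x :: real
  assumes "x > 0" "a > 0"
  shows "b / x powr (\<beta> + 2) \<le> a / x powr (\<alpha> + 2) \<longleftrightarrow> b / a \<le> x powr (\<beta> - \<alpha>)"
    and "b / x powr (\<beta> + 2) < a / x powr (\<alpha> + 2) \<longleftrightarrow> b / a < x powr (\<beta> - \<alpha>)"
  using assms powr_add [of x "\<beta> - \<alpha>" "\<alpha> + 2"] by (simp_all add: field_simps)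

lemma omega_radicand_pos:
  assumes ab: "0 < \<alpha>" "\<alpha> < \<beta>" and N: "N \<ge> 2" and l: "l > 2"
    and r: "r = G1 \<alpha> \<beta> N l / sqrt (l\<^sup>2 - 1)"
    and G1: "G1 \<alpha> \<beta> N l \<ge> (theta N \<beta> / theta N \<alpha>) powr (1 / (\<beta> - \<alpha>))"
  shows "omega_radicand \<alpha> \<beta> N l r > 0"
proof -
  have l1: "l > 1"
    using l by simp
  have r0: "r > 0" and quot: "(2 * l * r) powr (\<beta> - \<alpha>) = G1_quotient \<alpha> \<beta> N l"
    using diameter_powr [OF ab l1 r] by auto
  have sq: "sqrt (l\<^sup>2 - 1) > 0"
    using l1 by (simp add: one_less_power)
  have theta: "theta N \<alpha> > 0" "theta N \<beta> > 0"
    using theta_pos N ab by auto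
  define R where "R = sqrt (l\<^sup>2 - 1) * r"
  have R: "R = G1 \<alpha> \<beta> N l" "R > 0"
    using sq r0 by (simp add: R_def r) (simp add: R_def mult_pos_pos [OF sq r0])
  have "theta N \<beta> / theta N \<alpha> = ((theta N \<beta> / theta N \<alpha>) powr (1 / (\<beta> - \<alpha>))) powr (\<beta> - \<alpha>)"
    using ab theta by (simp add: powr_powr)
  also have "\<dots> \<le> R powr (\<beta> - \<alpha>)"
    using G1 ab by (intro powr_mono2) (auto simp: R)
  finally have ring: "theta N \<beta> / R powr (\<beta> + 2) \<le> theta N \<alpha> / R powr (\<alpha> + 2)"
    using frac_powr_compare(1) [OF R(2) theta(1)] by simp
  have "2 powr (\<beta> - \<alpha>) < l powr (\<beta> - \<alpha>)"
    using ab l by (intro powr_less_mono2) auto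
  \<comment> \<open>Multiplying by \<open>2 * l powr (\<alpha> + 2)\<close> and adding the common term \<open>2 powr (\<beta> + 2) * N\<close> compares
    the two factors of the quotient.\<close>
  then have *: "2 powr (\<beta> - \<alpha>) * (2 * l powr (\<alpha> + 2) + 2 powr (\<alpha> + 2) * real N) <
      2 * l powr (\<beta> + 2) + 2 powr (\<beta> + 2) * real N" (is "_ * ?V < ?W")
    using l powr_add [of l "\<beta> - \<alpha>" "\<alpha> + 2"] powr_add [of 2 "\<beta> - \<alpha>" "\<alpha> + 2"]
    by (simp add: algebra_simps)
  have "?V > 0"
    using l by (intro add_pos_nonneg) auto
  with * have "2 powr (\<beta> - \<alpha>) < ?W / ?V"
    by (simp add: pos_less_divide_eq)
  then have "\<beta> / \<alpha> * 2 powr (\<beta> - \<alpha>) < \<beta> / \<alpha> * (?W / ?V)"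
    using ab by (intro mult_strict_left_mono) auto
  also have "\<dots> = G1_quotient \<alpha> \<beta> N l"
    by (simp add: G1_quotient_def)
  also have "\<dots> = (l * r) powr (\<beta> - \<alpha>) * 2 powr (\<beta> - \<alpha>)"
    by (simp add: quot [symmetric] powr_mult)
  finally have "\<beta> / \<alpha> < (l * r) powr (\<beta> - \<alpha>)"
    by (rule mult_right_less_imp_less) simp
  then have "2 * \<beta> / (l * r) powr (\<beta> + 2) < 2 * \<alpha> / (l * r) powr (\<alpha> + 2)"
    using frac_powr_compare(2) [of "l * r" "2 * \<alpha>" "2 * \<beta>" \<beta> \<alpha>] ab l r0 by simp
  with ring show ?thesis
    by (simp add: omega_radicand_def R_def)
qed

section \<open>The rotating bipyramid as a solution\<close>

lemma bipyramid_solution: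
  assumes ab: "0 < \<alpha>" "\<alpha> < \<beta>" and N: "N \<ge> 2" and l: "l > 1"
    and r: "r = G1 \<alpha> \<beta> N l / sqrt (l\<^sup>2 - 1)" and \<omega>: "\<omega>\<^sup>2 = omega_radicand \<alpha> \<beta> N l r"
  shows "LJ_solution (2 + N) \<alpha> \<beta> (\<lambda>t k. E_rot \<omega> t *v q_init N l r k)"
proof -
  define R where "R = sqrt (l\<^sup>2 - 1) * r"
  have r0: "r > 0"
    using diameter_powr [OF ab l r] by simp
  have R0: "R > 0"
    using l r0 by (simp add: R_def one_less_power)
  have "R\<^sup>2 + r\<^sup>2 = (l * r)\<^sup>2"
    using l by (simp add: R_def power_mult_distrib algebra_simps one_le_power)
  then have d: "l * r = sqrt (R\<^sup>2 + r\<^sup>2)"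
    using l r0 by simp
  show ?thesis
  proof (rule LJ_solution_rotation [where Z = "bipyramid_hor N R" and C = "bipyramid_height r"])
    show "q_init N l r k = cyl (bipyramid_hor N R k) (bipyramid_height r k)" if "k \<in> {1..2 + N}" for k
      unfolding R_def using that by (intro q_init_cyl) auto
    show "q_init N l r \<in> LJ_config (2 + N)"
      by (rule q_init_in_LJ_config [OF N l r0])
    show "LJ_accel (2 + N) \<alpha> \<beta> (\<lambda>k. cyl (bipyramid_hor N R k) (bipyramid_height r k)) k =
        cyl (- of_real (\<omega>\<^sup>2) * bipyramid_hor N R k) 0" if k: "k \<in> {1..2 + N}" for k
    proof -
      consider s where "k = 1 \<and> s = 1 \<or> k = 2 \<and> s = (- 1 :: real)" | "k \<in> {3..2 + N}"
        using k by (metis Suc_1 Suc_leI atLeastAtMost_iff le_neq_implies_less numeral_3_eq_3 One_nat_def)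
      then show ?thesis
      proof cases
        case 1
        then have "bipyramid_hor N R k = 0"
          by (auto simp: bipyramid_hor_def)
        with apex_force [OF N R0 r0 d 1, of \<alpha> \<beta>] axial_balance [OF ab l r] show ?thesis
          by simp
      next
        case 2
        have "theta N \<beta> / R powr (\<beta> + 2) - theta N \<alpha> / R powr (\<alpha> + 2) + 2 * LJ_coeff \<alpha> \<beta> (l * r)
            = - \<omega>\<^sup>2"
          by (simp add: \<omega> omega_radicand_def LJ_coeff_def R_def)
        with ring_force [OF N R0 d 2, of \<alpha> \<beta>] show ?thesis
          by simp
      qed
    qed
  qed
qed

theorem theorem1p1:
  fixes \<alpha> \<beta> :: real and N :: nat
  assumes "0 < \<alpha>" and "\<alpha> < \<beta>" and "N \<ge> 2"
  shows "\<exists>l1>0.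
    (\<forall>l\<ge>l1. l \<ge> 2 \<longrightarrow> G1 \<alpha> \<beta> N l \<ge> (theta N \<beta> / theta N \<alpha>) powr (1 / (\<beta> - \<alpha>))) \<and>
    (\<forall>l\<ge>max 2 l1. \<forall>r0. r0 = G1 \<alpha> \<beta> N l / sqrt (l\<^sup>2 - 1) \<longrightarrow>
       omega_radicand \<alpha> \<beta> N l r0 > 0 \<and>
       (\<forall>\<omega>0. \<omega>0 = sqrt (omega_radicand \<alpha> \<beta> N l r0) \<or> \<omega>0 = - sqrt (omega_radicand \<alpha> \<beta> N l r0) \<longrightarrow>
          \<omega>0 \<noteq> 0 \<and>
          LJ_solution (2 + N) \<alpha> \<beta> (\<lambda>t k. E_rot \<omega>0 t *v q_init N l r0 k)))"
proof -
  define T where "T = (theta N \<beta> / theta N \<alpha>) powr (1 / (\<beta> - \<alpha>))"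
  define c where "c = (2 * \<beta> / (\<alpha> * (2 + real N))) powr (1 / (\<beta> - \<alpha>)) / 4"
  have c: "c > 0"
    using assms by (simp add: c_def add_pos_nonneg)
  \<comment> \<open>\<open>T / c\<close> comes from the bound \<open>c * l\<close> on \<open>G1\<close>; positivity of the radicand uses \<open>l > 2\<close>, hence \<open>3\<close>.\<close>
  define l1 where "l1 = max 3 (T / c)"
  have G1: "G1 \<alpha> \<beta> N l \<ge> T" if "l \<ge> l1" for l
  proof -
    have "T \<le> c * l"
      using that c by (simp add: l1_def field_simps)
    also have "\<dots> \<le> G1 \<alpha> \<beta> N l"
      unfolding c_def using that assms by (intro G1_lower_bound) (auto simp: l1_def)
    finally show ?thesis .
  qed
  have rad: "omega_radicand \<alpha> \<beta> N l (G1 \<alpha> \<beta> N l / sqrt (l\<^sup>2 - 1)) > 0" if "l \<ge> l1" for l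
    using that G1 [OF that] assms
    by (intro omega_radicand_pos) (auto simp: l1_def T_def)
  have sol: "LJ_solution (2 + N) \<alpha> \<beta>
      (\<lambda>t k. E_rot \<omega> t *v q_init N l (G1 \<alpha> \<beta> N l / sqrt (l\<^sup>2 - 1)) k)"
    if "l \<ge> l1" "\<omega>\<^sup>2 = omega_radicand \<alpha> \<beta> N l (G1 \<alpha> \<beta> N l / sqrt (l\<^sup>2 - 1))" for l \<omega>
    using that assms by (intro bipyramid_solution) (auto simp: l1_def)
  show ?thesis
  proof (intro exI [of _ l1] conjI allI impI)
    show "l1 > 0"
      by (simp add: l1_def)
    show "(theta N \<beta> / theta N \<alpha>) powr (1 / (\<beta> - \<alpha>)) \<le> G1 \<alpha> \<beta> N l" if "l \<ge> l1" for l
      using G1 [OF that] by (simp add: T_def)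
    fix l r0 assume l: "max 2 l1 \<le> l" and r0: "r0 = G1 \<alpha> \<beta> N l / sqrt (l\<^sup>2 - 1)"
    show pos: "omega_radicand \<alpha> \<beta> N l r0 > 0"
      using rad l r0 by simp
    fix \<omega> assume "\<omega> = sqrt (omega_radicand \<alpha> \<beta> N l r0) \<or> \<omega> = - sqrt (omega_radicand \<alpha> \<beta> N l r0)"
    with pos have \<omega>: "\<omega>\<^sup>2 = omega_radicand \<alpha> \<beta> N l r0"
      by auto
    with pos show "\<omega> \<noteq> 0"
      by auto
    show "LJ_solution (2 + N) \<alpha> \<beta> (\<lambda>t k. E_rot \<omega> t *v q_init N l r0 k)"
      using sol l \<omega> unfolding r0 by simp
  qed
qed

end
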